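(* Let $\{(X_t, g_t)\}_{t\in(-\varepsilon,1)}$ be a smooth family of compact Hermitian manifolds, with $\varepsilon>0$ small enough, and let $n$ be the complex dimension of the fibres. Suppose that, for every $t\in(0,1)$, the compact complex manifold $X_t$ is holomorphically-parallelizable, with a global co-frame $\{\varphi^1(t),\ldots,\varphi^n(t)\}$ of holomorphic $1$-forms on $X_t$ which is pointwise $g_t$-orthonormal (that is, orthonormal with respect to $g_t$ at every point of $X_t$). Then $X_0$ is holomorphically-parallelizable.
   Context: A compact complex manifold is called holomorphically-parallelizable if its holomorphic tangent bundle is holomorphically trivial; equivalently, if its holomorphic cotangent bundle is holomorphically trivial, i.e. it admits a global co-frame of holomorphic $1$-forms. A smooth (differentiable) family $\{(X_t,g_t)\}_{t\in(-\varepsilon,1)}$ of compact Hermitian manifolds is a differentiable family, in the sense of Kodaira and Spencer, of compact complex manifolds $X_t$ parametrized by $t\in(-\varepsilon,1)$, each endowed with a Hermitian metric $g_t$ varying smoothly in $t$. By the Ehresmann theorem, one can write $X_t=(X,J_t)$, where $X$ is a fixed compact differentiable manifold and $\{J_t\}_t$ is a family of (integrable) complex structures on $X$ varying smoothly in $t$; $g_t$ is then a Hermitian metric on $(X,J_t)$ for every $t\in(-\varepsilon,1)$, including $t\le 0$, varying smoothly in $t$. *)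

theory Defs
  imports "HOL-Analysis.Analysis"
begin

section \<open>Maps between open subsets of normed spaces\<close>

fun Ck_on :: "nat \<Rightarrow> ('a::real_normed_vector \<Rightarrow> 'b::real_normed_vector) \<Rightarrow> 'a set \<Rightarrow> bool" where
  "Ck_on 0 f S \<longleftrightarrow> continuous_on S f"
| "Ck_on (Suc k) f S \<longleftrightarrow>
     (\<forall>x\<in>S. f differentiable (at x)) \<and> (\<forall>v. Ck_on k (\<lambda>x. frechet_derivative f (at x) v) S)"

text \<open>Only meant for open \<open>S\<close>.\<close>

definition smooth_on :: "('a::real_normed_vector \<Rightarrow> 'b::real_normed_vector) \<Rightarrow> 'a set \<Rightarrow> bool" where
  "smooth_on f S \<longleftrightarrow> (\<forall>k. Ck_on k f S)"

text \<open>Holomorphy in several complex variables, on open \<open>S\<close>: the derivative exists and is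
  \<open>\<complex>\<close>-linear at every point.\<close>

definition holomorphic_map_on :: "(complex^'n \<Rightarrow> complex^'m) \<Rightarrow> (complex^'n) set \<Rightarrow> bool" where
  "holomorphic_map_on f S \<longleftrightarrow>
     (\<forall>x\<in>S. \<exists>D. (f has_derivative D) (at x) \<and> (\<forall>c v. D (c *s v) = c *s D v))"

definition complex_jacobian :: "(complex^'n \<Rightarrow> complex^'m) \<Rightarrow> complex^'n \<Rightarrow> complex^'n^'m" where
  "complex_jacobian f x = matrix (frechet_derivative f (at x))"


section \<open>Charts and atlases\<close>

text \<open>A chart is a pair of a domain and a coordinate map; the values of the coordinate map outside
  the domain are irrelevant. Manifolds are subsets of a Hausdorff second countable space, with the
  subspace topology.\<close>

type_synonym ('m, 'e) chart = "'m set \<times> ('m \<Rightarrow> 'e)"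

definition chart_image :: "('m, 'e) chart \<Rightarrow> 'e set" where
  "chart_image c = snd c ` fst c"

definition chart_inv :: "('m, 'e) chart \<Rightarrow> 'e \<Rightarrow> 'm" where
  "chart_inv c = inv_into (fst c) (snd c)"

definition chart_on ::
  "'m::{t2_space,second_countable_topology} set \<Rightarrow> ('m, 'e::real_normed_vector) chart \<Rightarrow> bool" where
  "chart_on S c \<longleftrightarrow> openin (top_of_set S) (fst c) \<and> open (chart_image c) \<and>
     homeomorphism (fst c) (chart_image c) (snd c) (chart_inv c)"

text \<open>\<open>transition c d\<close> is the change from the coordinates of \<open>c\<close> to those of \<open>d\<close>.\<close>

definition transition :: "('m, 'e) chart \<Rightarrow> ('m, 'f) chart \<Rightarrow> 'e \<Rightarrow> 'f" where
  "transition c d = snd d \<circ> chart_inv c"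

definition smooth_manifold ::
  "'m::{t2_space,second_countable_topology} set \<Rightarrow> ('m, 'e::euclidean_space) chart set \<Rightarrow> bool" where
  "smooth_manifold M A \<longleftrightarrow> (\<forall>c\<in>A. chart_on M c) \<and> (\<Union>c\<in>A. fst c) = M \<and>
     (\<forall>c\<in>A. \<forall>d\<in>A. smooth_on (transition c d) (snd c ` (fst c \<inter> fst d)))"

definition complex_manifold ::
  "'m::{t2_space,second_countable_topology} set \<Rightarrow> ('m, complex^'n) chart set \<Rightarrow> bool" where
  "complex_manifold X A \<longleftrightarrow> (\<forall>c\<in>A. chart_on X c) \<and> (\<Union>c\<in>A. fst c) = X \<and>
     (\<forall>c\<in>A. \<forall>d\<in>A. holomorphic_map_on (transition c d) (snd c ` (fst c \<inter> fst d)))"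

text \<open>\<open>tangent_change c d p\<close> sends the components of a tangent vector in \<open>T\<^sup>1\<^sup>,\<^sup>0\<close> at \<open>p\<close> with respect to
  the frame of coordinate fields of \<open>c\<close> to those with respect to the frame of \<open>d\<close>.\<close>

definition tangent_change ::
  "('m, complex^'n) chart \<Rightarrow> ('m, complex^'n) chart \<Rightarrow> 'm \<Rightarrow> complex^'n^'n" where
  "tangent_change c d p = complex_jacobian (transition c d) (snd c p)"


section \<open>Holomorphic one-forms and Hermitian metrics\<close>

text \<open>Tensor fields are given by their components in the charts of the atlas. For a one-form
  \<open>\<omega>\<close> of type (1,0), \<open>\<omega> c p $ k\<close> is the coefficient at \<open>p\<close> of \<open>dz\<^sup>k\<close>, where \<open>z = snd c\<close>.
  For a Hermitian metric \<open>g\<close>, \<open>g c p $ k $ l\<close> is the product of the coordinate vectors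
  \<open>\<partial>/\<partial>z\<^sup>k\<close> and \<open>\<partial>/\<partial>z\<^sup>l\<close> in the holomorphic tangent space at \<open>p\<close>.\<close>

type_synonym ('m, 'n) one_form = "('m, complex^'n) chart \<Rightarrow> 'm \<Rightarrow> complex^'n"

type_synonym ('m, 'n) metric = "('m, complex^'n) chart \<Rightarrow> 'm \<Rightarrow> complex^'n^'n"

definition holomorphic_one_form ::
  "('m, complex^'n) chart set \<Rightarrow> ('m, 'n::finite) one_form \<Rightarrow> bool" where
  "holomorphic_one_form A \<omega> \<longleftrightarrow>
     (\<forall>c\<in>A. \<forall>d\<in>A. \<forall>p \<in> fst c \<inter> fst d. \<omega> c p = \<omega> d p v* tangent_change c d p) \<and>
     (\<forall>c\<in>A. holomorphic_map_on (\<omega> c \<circ> chart_inv c) (chart_image c))"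

definition holomorphic_coframe ::
  "('m, complex^'n) chart set \<Rightarrow> ('n \<Rightarrow> ('m, 'n::finite) one_form) \<Rightarrow> bool" where
  "holomorphic_coframe A \<phi> \<longleftrightarrow> (\<forall>i. holomorphic_one_form A (\<phi> i)) \<and>
     (\<forall>c\<in>A. \<forall>p \<in> fst c. invertible (\<chi> i. \<phi> i c p))"

text \<open>A coframe \<open>\<phi>\<close> is the same thing as a holomorphic trivialization
  \<open>v \<mapsto> (\<phi>\<^sup>1(v), \<dots>, \<phi>\<^sup>n(v))\<close> of the holomorphic tangent bundle: over the chart \<open>c\<close> the
  trivialization is multiplication by the invertible matrix with rows \<open>\<phi> i c p\<close>.\<close>

definition holomorphically_parallelizable ::
  "'m::{t2_space,second_countable_topology} set \<Rightarrow> ('m, complex^'n) chart set \<Rightarrow> bool" where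
  "holomorphically_parallelizable X A \<longleftrightarrow>
     complex_manifold X A \<and> compact X \<and> (\<exists>\<phi>. holomorphic_coframe A \<phi>)"

definition sesquilinear :: "complex^'n^'n \<Rightarrow> complex^'n \<Rightarrow> complex^'n \<Rightarrow> complex" where
  "sesquilinear G u v = (\<Sum>k\<in>UNIV. \<Sum>l\<in>UNIV. G $ k $ l * u $ k * cnj (v $ l))"

definition hermitian_inner_product :: "complex^'n^'n \<Rightarrow> bool" where
  "hermitian_inner_product G \<longleftrightarrow>
     (\<forall>u v. sesquilinear G v u = cnj (sesquilinear G u v)) \<and>
     (\<forall>u. u \<noteq> 0 \<longrightarrow> Re (sesquilinear G u u) > 0)"

definition hermitian_metric ::
  "('m, complex^'n) chart set \<Rightarrow> ('m, 'n::finite) metric \<Rightarrow> bool" where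
  "hermitian_metric A g \<longleftrightarrow>
     (\<forall>c\<in>A. \<forall>p \<in> fst c. hermitian_inner_product (g c p)) \<and>
     (\<forall>c\<in>A. \<forall>d\<in>A. \<forall>p \<in> fst c \<inter> fst d. \<forall>u v.
        sesquilinear (g c p) u v =
        sesquilinear (g d p) (tangent_change c d p *v u) (tangent_change c d p *v v)) \<and>
     (\<forall>c\<in>A. smooth_on (g c \<circ> chart_inv c) (chart_image c))"

text \<open>The inner product induced on covectors. The vector \<open>b\<close> representing \<open>\<beta>\<close>, i.e. with
  \<open>\<beta>(u) = sesquilinear G u b\<close> for all \<open>u\<close>, is the complex conjugate of \<open>matrix_inv G *v \<beta>\<close>, and
  the product of \<open>\<alpha>\<close> and \<open>\<beta>\<close> is \<open>\<alpha>(b)\<close>.\<close>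

definition dual_inner_product :: "complex^'n^'n \<Rightarrow> complex^'n \<Rightarrow> complex^'n \<Rightarrow> complex" where
  "dual_inner_product G \<alpha> \<beta> = (\<Sum>k\<in>UNIV. \<alpha> $ k * cnj ((matrix_inv G *v \<beta>) $ k))"

definition orthonormal_coframe ::
  "('m, complex^'n) chart set \<Rightarrow> ('m, 'n::finite) metric \<Rightarrow> ('n \<Rightarrow> ('m, 'n) one_form) \<Rightarrow> bool" where
  "orthonormal_coframe A g \<phi> \<longleftrightarrow>
     (\<forall>c\<in>A. \<forall>p \<in> fst c. \<forall>i j.
        dual_inner_product (g c p) (\<phi> i c p) (\<phi> j c p) = (if i = j then 1 else 0))"


section \<open>Differentiable families\<close>

text \<open>A differentiable family over \<open>I\<close> consists of a total space \<open>M\<close>, a map \<open>\<pi>\<close> onto \<open>I\<close> and a set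
  \<open>F\<close> of pairs \<open>(U, z)\<close>, \<open>U\<close> open in \<open>M\<close>, such that the maps \<open>(z, \<pi>)\<close> form a smooth
  atlas of \<open>M\<close> (so \<open>\<pi>\<close> is a smooth submersion) and the restrictions of the maps \<open>z\<close> to the fibre
  over \<open>t\<close> form a holomorphic atlas, which is the complex structure of \<open>X\<^sub>t\<close>.\<close>

definition fibre :: "'m set \<Rightarrow> ('m \<Rightarrow> real) \<Rightarrow> real \<Rightarrow> 'm set" where
  "fibre M \<pi> t = {p \<in> M. \<pi> p = t}"

definition fibre_chart ::
  "('m \<Rightarrow> real) \<Rightarrow> real \<Rightarrow> ('m, complex^'n) chart \<Rightarrow> ('m, complex^'n) chart" where
  "fibre_chart \<pi> t c = (fibre (fst c) \<pi> t, snd c)"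

definition fibre_atlas ::
  "('m \<Rightarrow> real) \<Rightarrow> ('m, complex^'n) chart set \<Rightarrow> real \<Rightarrow> ('m, complex^'n) chart set" where
  "fibre_atlas \<pi> F t = fibre_chart \<pi> t ` F"

definition total_chart ::
  "('m \<Rightarrow> real) \<Rightarrow> ('m, complex^'n) chart \<Rightarrow> ('m, (complex^'n) \<times> real) chart" where
  "total_chart \<pi> c = (fst c, \<lambda>p. (snd c p, \<pi> p))"

text \<open>Properness of \<open>\<pi>\<close> is the hypothesis of the Ehresmann theorem. It implies that the fibres are
  compact, and conversely it holds whenever the fibres are compact and connected.\<close>

definition differentiable_family ::
  "real set \<Rightarrow> 'm::{t2_space,second_countable_topology} set \<Rightarrow> ('m \<Rightarrow> real) \<Rightarrow>
   ('m, complex^'n) chart set \<Rightarrow> bool" where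
  "differentiable_family I M \<pi> F \<longleftrightarrow>
     smooth_manifold M (total_chart \<pi> ` F) \<and>
     \<pi> ` M = I \<and>
     (\<forall>K\<subseteq>I. compact K \<longrightarrow> compact {p \<in> M. \<pi> p \<in> K}) \<and>
     (\<forall>t\<in>I. complex_manifold (fibre M \<pi> t) (fibre_atlas \<pi> F t))"

definition hermitian_family ::
  "real set \<Rightarrow> 'm::{t2_space,second_countable_topology} set \<Rightarrow> ('m \<Rightarrow> real) \<Rightarrow>
   ('m, complex^'n) chart set \<Rightarrow> (real \<Rightarrow> ('m, 'n::finite) metric) \<Rightarrow> bool" where
  "hermitian_family I M \<pi> F g \<longleftrightarrow>
     differentiable_family I M \<pi> F \<and>
     (\<forall>t\<in>I. hermitian_metric (fibre_atlas \<pi> F t) (g t)) \<and>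
     (\<forall>c\<in>F. smooth_on ((\<lambda>p. g (\<pi> p) (fibre_chart \<pi> (\<pi> p) c) p) \<circ> chart_inv (total_chart \<pi> c))
                      (chart_image (total_chart \<pi> c)))"

end

theory Submission
  imports Defs "HOL-Complex_Analysis.Cauchy_Integral_Formula"
begin

text \<open>Orthonormality says that the matrix \<open>P\<close> of the coframe in any chart satisfies
  \<open>P\<^sup>* P = cnj g\<close>. Since \<open>g\<close> is continuous up to \<open>t = 0\<close>, the coefficients of the coframes are
  locally bounded as \<open>t\<close> decreases to \<open>0\<close>. By compactness they converge pointwise along some
  filter finer than \<open>at_right 0\<close>, in all charts at once; the Cauchy estimates make the convergence
  locally uniform and the limits holomorphic. The transformation law and the relation
  \<open>P\<^sup>* P = cnj g\<close> pass to the limit, and the latter forces the limiting forms to be linearly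
  independent.\<close>

section \<open>Compactness for filters\<close>

text \<open>The forms for different \<open>t\<close> live on different fibres. They are compared in
  the charts of the total space: for a fixed coordinate value \<open>z\<close>, the coefficients at
  the point over \<open>t\<close> with coordinates \<open>z\<close> form a function of
  \<open>t\<close>, and these are the functions sent to a limit. The price is that a curve of
  constant coordinates in one chart has moving coordinates in another, so the transformation law
  needs more than pointwise convergence. A filter replaces the usual subsequence because convergence
  is wanted at every coordinate value of every chart simultaneously, in general an uncountable index
  set: the product of the corresponding balls is compact but need not be sequentially compact.
  Equicontinuity comes afterwards from holomorphy: a bound on a ball controls differences and Taylor
  remainders by constants that do not depend on \<open>t\<close>.\<close>

lemma convergent_subfilter:
  assumes "compact K" "F \<noteq> bot" "eventually (\<lambda>t. h t \<in> K) F"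
  obtains G L where "G \<noteq> bot" "G \<le> F" "(h \<longlongrightarrow> L) G"
proof -
  have "filtermap h F \<noteq> bot" "eventually (\<lambda>x. x \<in> K) (filtermap h F)"
    using assms by (auto simp: filtermap_bot_iff eventually_filtermap)
  then obtain L where L: "inf (nhds L) (filtermap h F) \<noteq> bot"
    using assms(1) unfolding compact_filter by blast
  \<comment> \<open>\<open>L\<close> is a cluster point of the image filter. Cutting
    \<open>F\<close> down to the preimages of the neighbourhoods of \<open>L\<close> forces
    convergence, as passing to a subsequence does; properness is the cluster point property pulled
    back along \<open>h\<close>.\<close>
  define G where "G = inf (filtercomap h (nhds L)) F"
  have "G \<noteq> bot"
  proof
    assume "G = bot"
    then have "eventually (\<lambda>_. False) G" by simp
    then obtain P Q where "eventually P (filtercomap h (nhds L))" "eventually Q F"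
      and PQ: "\<And>t. \<not> (P t \<and> Q t)"
      unfolding G_def eventually_inf by blast
    then obtain R where R: "eventually R (nhds L)" "\<And>t. R (h t) \<Longrightarrow> P t"
      unfolding eventually_filtercomap by blast
    have "eventually (\<lambda>y. \<exists>t. Q t \<and> h t = y) (filtermap h F)"
      unfolding eventually_filtermap by (rule eventually_mono[OF \<open>eventually Q F\<close>]) blast
    with R(1) have "eventually (\<lambda>_. False) (inf (nhds L) (filtermap h F))"
      unfolding eventually_inf using R(2) PQ by blast
    with L show False by (simp add: trivial_limit_def)
  qed
  moreover have "(h \<longlongrightarrow> L) G"
    unfolding G_def filterlim_iff_le_filtercomap by simp
  moreover have "G \<le> F" by (simp add: G_def)
  ultimately show thesis using that by blast
qed

text \<open>Tychonoff's theorem, used in place of a diagonal argument.\<close>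

lemma pointwise_convergent_subfilter:
  fixes h :: "'t \<Rightarrow> 'i \<Rightarrow> 'b::euclidean_space"
  assumes "F \<noteq> bot" and bdd: "\<And>i. i \<in> I \<Longrightarrow> eventually (\<lambda>t. norm (h t i) \<le> R i) F"
  obtains G L where "G \<noteq> bot" "G \<le> F" "\<And>i. i \<in> I \<Longrightarrow> ((\<lambda>t. h t i) \<longlongrightarrow> L i) G"
proof -
  \<comment> \<open>The bounds hold only eventually, from a moment that depends on \<open>i\<close>,
    so no single \<open>t\<close> need satisfy all of them. The truncation \<open>k\<close> lies in
    the product of balls for every \<open>t\<close>, and each of its components indexed by
    \<open>I\<close> eventually agrees with that of \<open>h\<close>. The radius
    \<open>\<bar>R i\<bar>\<close> keeps the default value 0 in the ball.\<close>
  define k where "k t i = (if norm (h t i) \<le> R i then h t i else 0)" for t i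
  have "compact (PiE UNIV (\<lambda>i. cball (0::'b) \<bar>R i\<bar>))"
    using compactin_PiE[of "\<lambda>_. euclidean" UNIV "\<lambda>i. cball (0::'b) \<bar>R i\<bar>"]
    by (simp add: euclidean_product_topology)
  moreover have "eventually (\<lambda>t. k t \<in> PiE UNIV (\<lambda>i. cball (0::'b) \<bar>R i\<bar>)) F"
    by (rule always_eventually) (auto simp: k_def)
  ultimately obtain G L where G: "G \<noteq> bot" "G \<le> F" and L: "(k \<longlongrightarrow> L) G"
    using convergent_subfilter \<open>F \<noteq> bot\<close> by metis
  have "((\<lambda>t. h t i) \<longlongrightarrow> L i) G" if "i \<in> I" for i
  proof -
    have "continuous_on UNIV (\<lambda>x. x i :: 'b)" by simp
    then have "((\<lambda>t. k t i) \<longlongrightarrow> L i) G"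
      using continuous_on_tendsto_compose[OF _ L, of UNIV "\<lambda>x. x i"] by simp
    moreover have "eventually (\<lambda>t. k t i = h t i) G"
      using filter_leD[OF G(2) bdd[OF that]] by (rule eventually_mono) (simp add: k_def)
    ultimately show ?thesis by (rule Lim_transform_eventually)
  qed
  with G show thesis by (rule that)
qed

section \<open>Cauchy estimates and limits of holomorphic maps\<close>

text \<open>Discs of radius \<open>r/4\<close> about points of \<open>cball 0 (r/2)\<close> stay
  inside \<open>ball 0 r\<close>, so Cauchy's inequality bounds the n-th derivative on the half disc
  by \<open>fact n * B / (r/4) ^ n\<close>. The Taylor remainders of order 0 and 1 then give 4 and
  \<open>2 * 4^2 = 32\<close>.\<close>

lemma holomorphic_Taylor_bounds:
  assumes hol: "g holomorphic_on ball 0 r" and B: "\<And>x. x \<in> ball 0 r \<Longrightarrow> norm (g x) \<le> B"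
    and "norm l \<le> r / 2" "0 < r"
  shows "norm (g l - g 0) \<le> 4 * B / r * norm l"
    and "norm (g l - g 0 - deriv g 0 * l) \<le> 32 * B / r\<^sup>2 * (norm l)\<^sup>2"
proof -
  have bound: "norm ((deriv ^^ n) g w) \<le> fact n * B / (r/4) ^ n" if "w \<in> cball 0 (r/2)" for n w
  proof (rule Cauchy_inequality)
    have sub: "cball w (r/4) \<subseteq> ball 0 r"
    proof
      fix x assume "x \<in> cball w (r/4)"
      then have "norm x \<le> norm w + r/4"
        using norm_triangle_ineq2[of x w] by (simp add: dist_norm norm_minus_commute)
      with that \<open>0 < r\<close> show "x \<in> ball 0 r" by simp
    qed
    show "g holomorphic_on ball w (r/4)" "continuous_on (cball w (r/4)) g"
      using hol sub ball_subset_cball holomorphic_on_subset holomorphic_on_imp_continuous_on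
      by (meson order_trans)+
    show "norm (g x) \<le> B" if "norm (w - x) = r/4" for x
      using that sub B by (auto simp: dist_norm subset_eq)
  qed (use \<open>0 < r\<close> in simp)
  have der: "((deriv ^^ i) g has_field_derivative (deriv ^^ Suc i) g x) (at x within cball 0 (r/2))"
    if "x \<in> cball 0 (r/2)" for i x
  proof -
    have "x \<in> ball 0 r" using that \<open>0 < r\<close> by simp
    moreover have "(deriv ^^ i) g holomorphic_on ball 0 r"
      using hol by (intro holomorphic_higher_deriv) auto
    ultimately show ?thesis
      by (auto intro: holomorphic_derivI has_field_derivative_at_within)
  qed
  have taylor: "norm (g l - (\<Sum>i\<le>n. (deriv ^^ i) g 0 * l ^ i / fact i))
      \<le> fact (Suc n) * B / (r/4) ^ Suc n * norm l ^ Suc n / fact n" for n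
    using complex_Taylor[of "cball 0 (r/2)" n "\<lambda>i. (deriv ^^ i) g" _ 0 l, OF _ der bound[of _ "Suc n"]]
      assms(3,4) by simp
  show "norm (g l - g 0) \<le> 4 * B / r * norm l"
    using taylor[of 0] by (simp add: mult_ac)
  show "norm (g l - g 0 - deriv g 0 * l) \<le> 32 * B / r\<^sup>2 * (norm l)\<^sup>2"
    using taylor[of 1] by (simp add: power2_eq_square algebra_simps)
qed

lemma norm_vec_le_sum: "norm x \<le> (\<Sum>k\<in>UNIV. norm (x $ k))"
  unfolding norm_vec_def by (intro L2_set_le_sum) simp

text \<open>A derivative is a priori only real linear, whereas a matrix with complex entries is
  determined by its action on a complex basis. The second hypothesis upgrades \<open>D\<close> to
  linearity over the field of the entries.\<close>

lemma complex_linear_matrix_works: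
  fixes D :: "complex^'n \<Rightarrow> complex^'m"
  assumes "linear D" "\<And>c v. D (c *s v) = c *s D v"
  shows "matrix D *v v = D v"
proof (rule matrix_works)
  show "Vector_Spaces.linear (*s) (*s) D"
    using assms linear_add[OF assms(1)]
    by unfold_locales (auto simp: vec.scale_right_distrib vec.scale_left_distrib)
qed

text \<open>Each component of \<open>f\<close> is restricted to the complex line through
  \<open>z\<close> in the direction of \<open>h\<close>, parametrized by a unit vector, which
  reduces the claim to one variable on the disc of radius \<open>r\<close>. The factor
  \<open>CARD('m)\<close> comes from summing over the components.\<close>

lemma holomorphic_map_bounds:
  fixes f :: "complex^'n \<Rightarrow> complex^'m"
  assumes hol: "holomorphic_map_on f (ball z r)" and B: "\<And>x. x \<in> ball z r \<Longrightarrow> norm (f x) \<le> B"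
    and "0 < r" and h: "norm h \<le> r / 2"
    and D: "(f has_derivative D) (at z)"
  shows "norm (f (z + h) - f z) \<le> 4 * real CARD('m) * B / r * norm h"
    and "norm (f (z + h) - f z - D h) \<le> 32 * real CARD('m) * B / r\<^sup>2 * (norm h)\<^sup>2"
proof -
  have "norm ((f (z + h) - f z) $ k) \<le> 4 * B / r * norm h \<and>
        norm ((f (z + h) - f z - D h) $ k) \<le> 32 * B / r\<^sup>2 * (norm h)\<^sup>2" for k
  proof (cases "h = 0")
    case True
    moreover have "D 0 = 0" using D has_derivative_bounded_linear linear_simps(3) by blast
    ultimately show ?thesis by simp
  next
    case False
    define u where "u = (1 / of_real (norm h) :: complex) *s h"
    have [simp]: "complex_of_real (norm h) *s u = h" using False by (simp add: u_def)
    have norm_su: "norm (l *s v) = norm l * norm v" for l and v :: "complex^'n"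
      by (simp add: norm_vec_def norm_mult L2_set_right_distrib)
    have [simp]: "norm u = 1" using False by (simp add: u_def norm_su norm_divide)
    define g where "g l = f (z + l *s u) $ k" for l
    have blin: "bounded_linear (\<lambda>l. l *s u)"
      by (rule linear_conv_bounded_linear[THEN iffD1], rule linearI)
        (auto simp: vec_eq_iff algebra_simps)
    have mem: "z + l *s u \<in> ball z r" if "l \<in> ball 0 r" for l
      using that by (simp add: dist_norm norm_su)
    have der: "(g has_field_derivative E u $ k) (at l)"
      if "(f has_derivative E) (at (z + l *s u))" "\<And>c v. E (c *s v) = c *s E v" for E l
    proof -
      have "((\<lambda>l. z + l *s u) has_derivative (\<lambda>l. l *s u)) (at l)"
        using bounded_linear_imp_has_derivative[OF blin]
        by (auto intro!: derivative_eq_intros)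
      from bounded_linear.has_derivative[OF bounded_linear_vec_nth[of k] has_derivative_compose[OF this that(1)]]
      show ?thesis
        by (simp add: has_field_derivative_def g_def[abs_def] that(2) mult_commute_abs)
    qed
    have "\<exists>E. (f has_derivative E) (at (z + l *s u)) \<and> (\<forall>c v. E (c *s v) = c *s E v)"
      if "l \<in> ball 0 r" for l
      using hol mem[OF that] unfolding holomorphic_map_on_def by blast
    then have g_hol: "g holomorphic_on ball 0 r"
      by (meson der holomorphic_on_open open_ball)
    have g_B: "norm (g l) \<le> B" if "l \<in> ball 0 r" for l
      using B[OF mem[OF that]] unfolding g_def
      by (meson Finite_Cartesian_Product.norm_nth_le order_trans)
    obtain E where "(f has_derivative E) (at z)" "\<And>c v. E (c *s v) = c *s E v"
      using hol \<open>0 < r\<close> unfolding holomorphic_map_on_def by (metis centre_in_ball)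
    with D have D_lin: "D (c *s v) = c *s D v" for c v using has_derivative_unique by blast
    have "deriv g 0 = D u $ k"
      by (rule DERIV_imp_deriv, rule der) (use D D_lin in auto)
    moreover have "D h = complex_of_real (norm h) *s D u"
      using D_lin[of "complex_of_real (norm h)" u] by simp
    ultimately show ?thesis
      using holomorphic_Taylor_bounds[OF g_hol g_B, of "complex_of_real (norm h)"] h \<open>0 < r\<close>
      by (simp add: mult.commute) (simp add: g_def mult.commute)
  qed
  then have "norm (f (z + h) - f z) \<le> (\<Sum>k\<in>(UNIV::'m set). 4 * B / r * norm h)"
    and "norm (f (z + h) - f z - D h) \<le> (\<Sum>k\<in>(UNIV::'m set). 32 * B / r\<^sup>2 * (norm h)\<^sup>2)"
    by (blast intro: order_trans[OF norm_vec_le_sum sum_mono])+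
  then show "norm (f (z + h) - f z) \<le> 4 * real CARD('m) * B / r * norm h"
    and "norm (f (z + h) - f z - D h) \<le> 32 * real CARD('m) * B / r\<^sup>2 * (norm h)\<^sup>2"
    by (simp_all add: algebra_simps)
qed

text \<open>The Jacobians at \<open>z\<close> are bounded, so they have a cluster point
  \<open>L\<close>. The quadratic Taylor estimate has a constant independent of \<open>t\<close> and
  passes to the limit along the finer filter; there it says that \<open>L\<close> is the derivative
  of \<open>f0\<close>. Being a matrix, \<open>L\<close> is complex linear.\<close>

lemma holomorphic_map_on_limit:
  fixes f :: "'t \<Rightarrow> complex^'n \<Rightarrow> complex^'m"
  assumes "F \<noteq> bot" "0 < r"
    and hol: "eventually (\<lambda>t. holomorphic_map_on (f t) (ball z r)) F"
    and bdd: "eventually (\<lambda>t. \<forall>x\<in>ball z r. norm (f t x) \<le> B) F"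
    and lim: "\<And>x. x \<in> ball z r \<Longrightarrow> ((\<lambda>t. f t x) \<longlongrightarrow> f0 x) F"
  shows "\<exists>D. (f0 has_derivative D) (at z) \<and> (\<forall>c v. D (c *s v) = c *s D v)"
proof -
  define J where "J t = matrix (frechet_derivative (f t) (at z))" for t
  define C where "C = 32 * real CARD('m) * B / r\<^sup>2"
  have hb: "(\<forall>h. norm h \<le> r/2 \<longrightarrow> norm (f t (z + h) - f t z - J t *v h) \<le> C * (norm h)\<^sup>2 )
      \<and> (\<forall>v. norm (J t *v v) \<le> (2*B + C*(r/2)\<^sup>2) * (2 / r) * norm v)"
    if hol: "holomorphic_map_on (f t) (ball z r)" and B: "\<forall>x\<in>ball z r. norm (f t x) \<le> B" for t
  proof -
    obtain D where D: "(f t has_derivative D) (at z)" "\<And>c v. D (c *s v) = c *s D v"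
      using hol \<open>0 < r\<close> unfolding holomorphic_map_on_def by (metis centre_in_ball)
    have lin: "linear D" using D(1) has_derivative_linear by blast
    have JD: "J t *v v = D v" for v
      unfolding J_def frechet_derivative_at[OF D(1), symmetric]
      using lin D(2) by (rule complex_linear_matrix_works)
    have tay: "norm (f t (z + h) - f t z - J t *v h) \<le> C * (norm h)\<^sup>2" if "norm h \<le> r/2" for h
      unfolding JD C_def using holomorphic_map_bounds(2)[OF hol _ \<open>0 < r\<close> that D(1)] B by blast
    have "norm (J t *v v) \<le> (2*B + C*(r/2)\<^sup>2) * (2 / r) * norm v" for v
    proof (cases "v = 0")
      case False
      \<comment> \<open>Rescaling \<open>v\<close> to length \<open>r/2\<close>, the limit of
        validity of the Taylor estimate, bounds the linear term by two values of \<open>f t\<close>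
        and the remainder. Scaling back produces the factor \<open>2 / r\<close>.\<close>
      define h where "h = (r / (2 * norm v)) *\<^sub>R v"
      have nh: "norm h = r/2" using False \<open>0 < r\<close> by (simp add: h_def)
      have "norm (J t *v h) \<le> norm (f t (z + h)) + norm (f t z) + norm (f t (z + h) - f t z - J t *v h)"
        by norm
      also have "\<dots> \<le> B + B + C * (r/2)\<^sup>2"
        using tay[of h] nh B \<open>0 < r\<close> by (intro add_mono) (auto simp: dist_norm)
      finally have "norm (D h) \<le> 2*B + C*(r/2)\<^sup>2" by (simp add: JD)
      moreover have "D v = (2 * norm v / r) *\<^sub>R D h"
        using False \<open>0 < r\<close> by (simp add: h_def linear_cmul[OF lin])
      ultimately have "norm (D v) \<le> (2 * norm v / r) * (2*B + C*(r/2)\<^sup>2)"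
        using False \<open>0 < r\<close> by (simp add: mult_left_mono del: times_divide_eq_left)
      then show ?thesis by (simp add: JD mult_ac)
    qed simp
    with tay show ?thesis by blast
  qed
  define R where "R = (\<Sum>k\<in>(UNIV::'m set). \<Sum>l\<in>(UNIV::'n set). (2*B + C*(r/2)\<^sup>2) * (2 / r))"
  have good: "eventually (\<lambda>t. (\<forall>h. norm h \<le> r/2 \<longrightarrow>
      norm (f t (z + h) - f t z - J t *v h) \<le> C * (norm h)\<^sup>2) \<and> J t \<in> cball 0 R) F"
    using hol bdd
  proof eventually_elim
    case (elim t)
    have "norm (J t $ k $ l) \<le> (2*B + C*(r/2)\<^sup>2) * (2 / r)" for k l
    proof -
      have norm_axis: "norm (axis l (1::complex)) = 1"
        by (simp add: norm_vec_def L2_set_def axis_def if_distribR if_distrib cong: if_cong)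
      have "J t $ k $ l = (J t *v axis l 1) $ k"
        by (simp add: matrix_vector_mult_def axis_def if_distrib cong: if_cong)
      then have "norm (J t $ k $ l) \<le> norm (J t *v axis l 1)"
        by (simp add: Finite_Cartesian_Product.norm_nth_le)
      also have "\<dots> \<le> (2*B + C*(r/2)\<^sup>2) * (2 / r)"
        using conjunct2[OF hb[OF elim], rule_format, of "axis l 1"] norm_axis by simp
      finally show ?thesis .
    qed
    then have "norm (J t) \<le> R" unfolding R_def
      by (intro order_trans[OF norm_vec_le_sum sum_mono])
    with hb[OF elim] show ?case by simp
  qed
  have "eventually (\<lambda>t. J t \<in> cball 0 R) F"
    using good by (rule eventually_mono) blast
  then obtain G L where G: "G \<noteq> bot" "G \<le> F" and L: "(J \<longlongrightarrow> L) G"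
    using convergent_subfilter[OF compact_cball \<open>F \<noteq> bot\<close>] by metis
  have est: "norm (f0 (z + h) - f0 z - L *v h) \<le> C * (norm h)\<^sup>2" if "norm h \<le> r/2" for h
  proof (rule tendsto_upperbound)
    have "((\<lambda>t. J t *v h) \<longlongrightarrow> L *v h) G"
      unfolding matrix_vector_mult_def using L by (intro tendsto_intros) auto
    moreover have "z + h \<in> ball z r" "z \<in> ball z r"
      using that \<open>0 < r\<close> by (auto simp: dist_norm)
    ultimately show "((\<lambda>t. norm (f t (z + h) - f t z - J t *v h))
        \<longlongrightarrow> norm (f0 (z + h) - f0 z - L *v h)) G"
      using lim G(2) by (intro tendsto_intros) (auto intro: tendsto_mono)
    show "eventually (\<lambda>t. norm (f t (z + h) - f t z - J t *v h) \<le> C * (norm h)\<^sup>2) G"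
      by (rule filter_leD[OF G(2)], rule eventually_mono[OF good]) (use that in blast)
  qed fact
  have "(f0 has_derivative (*v) L) (at z)"
    unfolding has_derivative_at2
  proof (intro conjI)
    show "bounded_linear ((*v) L)"
      by (rule linear_conv_bounded_linear[THEN iffD1], rule linearI)
        (auto simp: matrix_vector_mult_def vec_eq_iff algebra_simps sum.distrib scaleR_sum_right)
    have "((\<lambda>y. C * norm (y - z)) \<longlongrightarrow> C * norm (z - z)) (at z)"
      by (intro tendsto_intros)
    then have *: "((\<lambda>y. C * norm (y - z)) \<longlongrightarrow> 0) (at z)" by simp
    have "eventually (\<lambda>y. y \<in> ball z (r/2)) (at z)"
      using \<open>0 < r\<close> by (intro eventually_at_in_open') auto
    then have "eventually (\<lambda>y. norm ((1 / norm (y - z)) *\<^sub>R (f0 y - (f0 z + L *v (y - z)))) \<le> C * norm (y - z)) (at z)"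
      using eventually_neq_at_within[of z z UNIV]
    proof eventually_elim
      case (elim y)
      then have "norm (f0 y - (f0 z + L *v (y - z))) \<le> C * (norm (y - z))\<^sup>2"
        using est[of "y - z"] by (simp add: dist_norm norm_minus_commute diff_diff_eq)
      with elim show ?case by (simp add: divide_simps power2_eq_square mult_ac)
    qed
    then show "((\<lambda>y. (1 / norm (y - z)) *\<^sub>R (f0 y - (f0 z + L *v (y - z)))) \<longlongrightarrow> 0) (at z)"
      by (rule Lim_null_comparison[OF _ *])
  qed
  moreover have "L *v (c *s v) = c *s (L *v v)" for c v
    by (simp add: vec_eq_iff matrix_vector_mult_def sum_distrib_left mult_ac)
  ultimately show ?thesis by blast
qed

section \<open>Orthonormal coframes at a point\<close>

lemma hermitian_inner_product_invertible:
  assumes "hermitian_inner_product G"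
  shows "invertible G"
proof -
  have "w = 0" if "G *v w = 0" for w
  proof (rule ccontr)
    \<comment> \<open>\<open>sesquilinear\<close> conjugates its second argument, so a kernel vector
      \<open>w\<close> of \<open>G\<close> is a null vector of the form only after
      conjugation.\<close>
    define v where "v = (\<chi> k. cnj (w $ k))"
    assume "w \<noteq> 0"
    then have "v \<noteq> 0" by (simp add: v_def vec_eq_iff)
    have "sesquilinear G v v = (\<Sum>k\<in>UNIV. v $ k * (G *v w) $ k)"
      by (simp add: sesquilinear_def v_def matrix_vector_mult_def sum_distrib_left mult_ac)
    also have "\<dots> = 0" using that by simp
    finally have "Re (sesquilinear G v v) = 0" by simp
    with assms \<open>v \<noteq> 0\<close> show False by (metis hermitian_inner_product_def less_irrefl)
  qed
  then show ?thesis
    by (simp add: invertible_left_inverse matrix_left_invertible_ker)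
qed

text \<open>With \<open>P\<close> the matrix of the coframe, orthonormality reads
  \<open>P * cnj (inverse G) * P\<^sup>* = 1\<close>, which is inverted to \<open>cnj G = P\<^sup>* * P\<close>.\<close>

lemma sesquilinear_orthonormal:
  fixes P :: "complex^'n^'n"
  assumes G: "hermitian_inner_product G"
    and orth: "\<And>i j. dual_inner_product G (P $ i) (P $ j) = (if i = j then 1 else 0)"
  shows "sesquilinear G u v = (\<Sum>i\<in>UNIV. (P *v u) $ i * cnj ((P *v v) $ i))"
proof -
  define cm :: "complex^'n^'n \<Rightarrow> complex^'n^'n" where "cm A = (\<chi> k l. cnj (A $ k $ l))" for A
  have "G ** matrix_inv G = mat 1"
    using someI_ex[OF hermitian_inner_product_invertible[OF G, unfolded invertible_def]]
    unfolding matrix_inv_def by blast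
  then have "cm (G ** matrix_inv G) = cm (mat 1)" by simp
  then have GN: "cm G ** cm (matrix_inv G) = mat 1"
    by (simp add: cm_def matrix_matrix_mult_def mat_def vec_eq_iff if_distrib cong: if_cong)
  have "P ** (cm (matrix_inv G) ** transpose (cm P)) = mat 1"
    using orth by (simp add: vec_eq_iff dual_inner_product_def matrix_matrix_mult_def
        matrix_vector_mult_def mat_def transpose_def cm_def)
  \<comment> \<open>For square matrices a right inverse is also a left inverse. This moves
    \<open>P\<close> to the other side, where multiplication by \<open>cm G\<close> cancels the
    inverse metric.\<close>
  then have "(cm (matrix_inv G) ** transpose (cm P)) ** P = mat 1"
    by (simp add: matrix_left_right_inverse)
  then have "cm G ** ((cm (matrix_inv G) ** transpose (cm P)) ** P) = cm G" by simp
  then have PP: "transpose (cm P) ** P = cm G"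
    by (simp add: matrix_mul_assoc GN)
  have "G $ k $ l = (\<Sum>i\<in>UNIV. P $ i $ k * cnj (P $ i $ l))" for k l
  proof -
    have "cnj ((transpose (cm P) ** P) $ k $ l) = G $ k $ l"
      unfolding PP by (simp add: cm_def)
    then show ?thesis by (simp add: matrix_matrix_mult_def transpose_def cm_def)
  qed
  then have "sesquilinear G u v =
      (\<Sum>k\<in>UNIV. \<Sum>l\<in>UNIV. \<Sum>i\<in>UNIV. (P $ i $ k * u $ k) * cnj (P $ i $ l * v $ l))"
    by (simp add: sesquilinear_def sum_distrib_left sum_distrib_right mult_ac)
  also have "\<dots> = (\<Sum>k\<in>UNIV. \<Sum>i\<in>UNIV. \<Sum>l\<in>UNIV. (P $ i $ k * u $ k) * cnj (P $ i $ l * v $ l))"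
    by (intro sum.cong refl sum.swap)
  also have "\<dots> = (\<Sum>i\<in>UNIV. \<Sum>k\<in>UNIV. \<Sum>l\<in>UNIV. (P $ i $ k * u $ k) * cnj (P $ i $ l * v $ l))"
    by (rule sum.swap)
  finally show ?thesis
    by (simp add: matrix_vector_mult_def sum_product)
qed

text \<open>On the k-th coordinate vector the hypothesis reads
  \<open>G $ k $ k = (\<Sum>i\<in>UNIV. (norm (P $ i $ k))\<^sup>2)\<close>, so a diagonal entry of
  \<open>G\<close> dominates the squares of a whole column of \<open>P\<close>. The summand 1 comes
  from \<open>a \<le> a\<^sup>2 + 1\<close>, which avoids a square root, and \<open>CARD('n)\<close>
  from summing the entries of a row.\<close>

lemma norm_row_le:
  fixes P :: "complex^'n^'n"
  assumes "\<And>u. sesquilinear G u u = (\<Sum>i\<in>UNIV. (P *v u) $ i * cnj ((P *v u) $ i))"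
  shows "norm (P $ i) \<le> CARD('n) * (norm G + 1)"
proof -
  have "norm (P $ i $ k) \<le> norm G + 1" for k
  proof -
    have Pk: "(P *v axis k 1) $ i = P $ i $ k" for i
      by (simp add: matrix_vector_mult_def axis_def if_distrib cong: if_cong)
    have "sesquilinear G (axis k 1) (axis k 1) = G $ k $ k"
      unfolding sesquilinear_def axis_def
      by (simp add: if_distrib[of "(*) _"] if_distrib[of cnj] if_distribR cong: if_cong)
    with assms[of "axis k 1"] have "G $ k $ k = (\<Sum>i\<in>UNIV. P $ i $ k * cnj (P $ i $ k))"
      unfolding Pk by simp
    also have "\<dots> = of_real (\<Sum>i\<in>UNIV. (norm (P $ i $ k))\<^sup>2)"
      by (simp add: complex_norm_square del: of_real_power)
    finally have "norm (G $ k $ k) = (\<Sum>i\<in>UNIV. (norm (P $ i $ k))\<^sup>2)"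
      by (simp only: norm_of_real) (simp add: sum_nonneg)
    moreover have "(norm (P $ i $ k))\<^sup>2 \<le> (\<Sum>i\<in>UNIV. (norm (P $ i $ k))\<^sup>2)"
      by (rule member_le_sum) auto
    moreover have "norm (G $ k $ k) \<le> norm G"
      by (meson Finite_Cartesian_Product.norm_nth_le order_trans)
    moreover have "norm (P $ i $ k) \<le> (norm (P $ i $ k))\<^sup>2 + 1"
      using zero_le_power2[of "norm (P $ i $ k) - 1"] norm_ge_zero[of "P $ i $ k"]
      by (simp add: power2_diff del: norm_ge_zero zero_le_power2)
    ultimately show ?thesis by linarith
  qed
  then have "norm (P $ i) \<le> (\<Sum>k\<in>(UNIV::'n set). norm G + 1)"
    by (intro order_trans[OF norm_vec_le_sum sum_mono])
  then show ?thesis by simp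
qed

text \<open>A vector killed by \<open>P\<close> has length zero for \<open>G\<close>, hence vanishes
  by positive definiteness.\<close>

lemma invertible_if_sesquilinear:
  fixes P :: "complex^'n^'n"
  assumes "hermitian_inner_product G"
    and "\<And>u. sesquilinear G u u = (\<Sum>i\<in>UNIV. (P *v u) $ i * cnj ((P *v u) $ i))"
  shows "invertible P"
proof -
  have "u = 0" if "P *v u = 0" for u
  proof -
    have "Re (sesquilinear G u u) = 0" using assms(2)[of u] that by simp
    then show ?thesis using assms(1) by (metis hermitian_inner_product_def less_irrefl)
  qed
  then show ?thesis
    by (simp add: invertible_left_inverse matrix_left_invertible_ker)
qed

section \<open>Charts of a family and of its fibres\<close>

lemma holomorphic_map_on_cong_subset:
  assumes "holomorphic_map_on f S" "open T" "T \<subseteq> S" "\<And>x. x \<in> T \<Longrightarrow> f x = g x"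
  shows "holomorphic_map_on g T"
  unfolding holomorphic_map_on_def
proof
  fix x assume "x \<in> T"
  then obtain D where D: "(f has_derivative D) (at x)" "\<forall>c v. D (c *s v) = c *s D v"
    using assms unfolding holomorphic_map_on_def by blast
  from has_derivative_transform_within_open[OF D(1) assms(2) \<open>x \<in> T\<close> assms(4)]
  show "\<exists>D. (g has_derivative D) (at x) \<and> (\<forall>c v. D (c *s v) = c *s D v)"
    using D(2) by blast
qed

lemma tendsto_slice:
  fixes f :: "'a::t2_space \<times> 'b::t2_space \<Rightarrow> 'c::topological_space"
  assumes "continuous_on U f" "open U" "(z, t0) \<in> U"
  shows "((\<lambda>t. f (z, t)) \<longlongrightarrow> f (z, t0)) (at t0)"
proof -
  have "isCont f (z, t0)" using assms by (simp add: continuous_on_eq_continuous_at)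
  moreover have "((\<lambda>t. (z, t)) \<longlongrightarrow> (z, t0)) (at t0)" by (intro tendsto_intros)
  ultimately show ?thesis by (rule isCont_tendsto_compose)
qed

lemma eventually_slice:
  assumes "open U" "(z, t0) \<in> U"
  shows "eventually (\<lambda>t. (z, t) \<in> U) (at t0)"
proof -
  have "((\<lambda>t. (z, t)) \<longlongrightarrow> (z, t0)) (at t0)" by (intro tendsto_intros)
  then show ?thesis using assms by (rule topological_tendstoD)
qed

lemma open_slice: "open U \<Longrightarrow> open {z. (z, t) \<in> U}"
  using open_vimage[of U "\<lambda>z. (z, t)", OF _ continuous_on_Pair[OF continuous_on_id continuous_on_const]]
  by (simp add: vimage_def)

lemma chart_inv_apply: "chart_on S c \<Longrightarrow> p \<in> fst c \<Longrightarrow> chart_inv c (snd c p) = p"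
  by (simp add: chart_on_def homeomorphism_def)

lemma open_chart_inter:
  assumes "chart_on S c" "chart_on S d"
  shows "open (snd c ` (fst c \<inter> fst d))"
proof -
  have "openin (top_of_set (fst c)) (fst c \<inter> fst d)"
    using assms unfolding chart_on_def
    by (meson Int_lower1 openin_Int openin_imp_subset openin_subset_trans)
  then have "openin (top_of_set (chart_image c)) (snd c ` (fst c \<inter> fst d))"
    using assms unfolding chart_on_def by (meson homeomorphism_imp_open_map)
  then show ?thesis
    using assms unfolding chart_on_def by (meson openin_open_eq)
qed

lemma chart_image_total:
  "(z, t) \<in> chart_image (total_chart \<pi> c) \<longleftrightarrow> (\<exists>p\<in>fst c. snd c p = z \<and> \<pi> p = t)"
  by (auto simp: chart_image_def total_chart_def)

lemma chart_image_fibre: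
  "chart_image (fibre_chart \<pi> t c) = {z. (z, t) \<in> chart_image (total_chart \<pi> c)}"
  by (auto simp: chart_image_def total_chart_def fibre_chart_def fibre_def)

lemma total_chart_inv:
  assumes "(z, t) \<in> chart_image (total_chart \<pi> c)"
  shows "chart_inv (total_chart \<pi> c) (z, t) \<in> fst c"
    and "snd c (chart_inv (total_chart \<pi> c) (z, t)) = z"
    and "\<pi> (chart_inv (total_chart \<pi> c) (z, t)) = t"
  using assms inv_into_into[of "(z, t)" "snd (total_chart \<pi> c)" "fst (total_chart \<pi> c)"]
    f_inv_into_f[of "(z, t)" "snd (total_chart \<pi> c)" "fst (total_chart \<pi> c)"]
  by (simp_all add: chart_inv_def chart_image_def total_chart_def)

text \<open>Both inverses are made by choice and are meaningful only on the respective images. On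
  the fibre over \<open>t\<close> the last coordinate of the total chart is constant, so injectivity
  of the total chart makes \<open>snd c\<close> alone injective there.\<close>

lemma fibre_chart_inv:
  assumes c: "chart_on M (total_chart \<pi> c)" and zt: "(z, t) \<in> chart_image (total_chart \<pi> c)"
  shows "chart_inv (fibre_chart \<pi> t c) z = chart_inv (total_chart \<pi> c) (z, t)"
  unfolding chart_inv_def[of "fibre_chart \<pi> t c"]
proof (rule inv_into_f_eq)
  show "inj_on (snd (fibre_chart \<pi> t c)) (fst (fibre_chart \<pi> t c))"
  proof (rule inj_onI)
    fix p q assume "p \<in> fst (fibre_chart \<pi> t c)" "q \<in> fst (fibre_chart \<pi> t c)"
      "snd (fibre_chart \<pi> t c) p = snd (fibre_chart \<pi> t c) q"
    then show "p = q"
      using chart_inv_apply[OF c, of p] chart_inv_apply[OF c, of q]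
      by (simp add: fibre_chart_def fibre_def total_chart_def)
  qed
qed (use total_chart_inv[OF zt] in \<open>simp_all add: fibre_chart_def fibre_def\<close>)

text \<open>In coordinates, the transition on the fibre over \<open>t\<close> is the slice at
  \<open>t\<close> of the transition of the total space, so by the chain rule its derivative is the
  total derivative on vectors \<open>(h, 0)\<close>. The Jacobians on all fibres thus come from one
  map that is smooth in \<open>z\<close> and \<open>t\<close> jointly.\<close>

lemma tangent_change_fibre:
  assumes c: "chart_on M (total_chart \<pi> c)" and d: "chart_on M (total_chart \<pi> d)"
    and sm: "smooth_on (transition (total_chart \<pi> c) (total_chart \<pi> d))
      (snd (total_chart \<pi> c) ` (fst c \<inter> fst d))"
    and p: "p \<in> fst c \<inter> fst d" "\<pi> p = t"
  shows "tangent_change (fibre_chart \<pi> t c) (fibre_chart \<pi> t d) p =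
    (\<chi> i j. fst (frechet_derivative (transition (total_chart \<pi> c) (total_chart \<pi> d))
      (at (snd c p, t)) (axis j 1, 0)) $ i)"
proof -
  define T where "T = transition (total_chart \<pi> c) (total_chart \<pi> d)"
  define U where "U = snd (total_chart \<pi> c) ` (fst c \<inter> fst d)"
  have "open U" using open_chart_inter[OF c d] by (simp add: U_def total_chart_def)
  have z: "(snd c p, t) \<in> U" using p by (auto simp: U_def total_chart_def)
  have "Ck_on (Suc 0) T U" using sm by (simp only: smooth_on_def T_def U_def)
  then have "T differentiable at (snd c p, t)" using z by simp
  then have T': "(T has_derivative frechet_derivative T (at (snd c p, t))) (at (snd c p, t))"
    by (simp add: frechet_derivative_works)
  have pair: "((\<lambda>z. (z, t)) has_derivative (\<lambda>h. (h, 0))) (at (snd c p))"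
    by (auto intro!: derivative_eq_intros)
  have "((\<lambda>z. fst (T (z, t))) has_derivative
      (\<lambda>h. fst (frechet_derivative T (at (snd c p, t)) (h, 0)))) (at (snd c p))"
    by (rule bounded_linear.has_derivative[OF bounded_linear_fst has_derivative_compose[OF pair T']])
  then have "(transition (fibre_chart \<pi> t c) (fibre_chart \<pi> t d) has_derivative
      (\<lambda>h. fst (frechet_derivative T (at (snd c p, t)) (h, 0)))) (at (snd c p))"
  proof (rule has_derivative_transform_within_open)
    show "open {z. (z, t) \<in> U}" using open_slice[OF \<open>open U\<close>] .
    show "snd c p \<in> {z. (z, t) \<in> U}" using z by simp
    fix x assume "x \<in> {z. (z, t) \<in> U}"
    then have "(x, t) \<in> chart_image (total_chart \<pi> c)"
      by (auto simp: U_def chart_image_def total_chart_def)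
    from fibre_chart_inv[OF c this]
    show "fst (T (x, t)) = transition (fibre_chart \<pi> t c) (fibre_chart \<pi> t d) x"
      by (simp add: T_def transition_def total_chart_def fibre_chart_def)
  qed
  note D = frechet_derivative_at[OF this, symmetric]
  have "snd (fibre_chart \<pi> t c) = snd c" by (simp add: fibre_chart_def)
  then show ?thesis
    unfolding tangent_change_def complex_jacobian_def matrix_def T_def[symmetric] by (simp add: D)
qed

text \<open>The curve \<open>q\<close> passes through \<open>p\<close> at \<open>t0\<close>, meets
  each nearby fibre once and has constant coordinates in \<open>c\<close>. Continuity of the total
  transition controls its coordinates in \<open>d\<close>; continuity of the first derivatives
  controls the Jacobians along it.\<close>

lemma tangent_change_tendsto:
  assumes c: "chart_on M (total_chart \<pi> c)" and d: "chart_on M (total_chart \<pi> d)"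
    and sm: "smooth_on (transition (total_chart \<pi> c) (total_chart \<pi> d))
      (snd (total_chart \<pi> c) ` (fst c \<inter> fst d))"
    and p: "p \<in> fst c \<inter> fst d" "\<pi> p = t0"
  defines "q \<equiv> \<lambda>t. chart_inv (total_chart \<pi> c) (snd c p, t)"
  shows "eventually (\<lambda>t. q t \<in> fst c \<inter> fst d \<and> \<pi> (q t) = t) (at t0)"
    and "((\<lambda>t. snd d (q t)) \<longlongrightarrow> snd d p) (at t0)"
    and "((\<lambda>t. tangent_change (fibre_chart \<pi> t c) (fibre_chart \<pi> t d) (q t))
      \<longlongrightarrow> tangent_change (fibre_chart \<pi> t0 c) (fibre_chart \<pi> t0 d) p) (at t0)"
proof -
  define T where "T = transition (total_chart \<pi> c) (total_chart \<pi> d)"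
  define U where "U = snd (total_chart \<pi> c) ` (fst c \<inter> fst d)"
  have "open U" using open_chart_inter[OF c d] by (simp add: U_def total_chart_def)
  have z: "(snd c p, t0) \<in> U" using p by (auto simp: U_def total_chart_def)
  have qU: "q t \<in> fst c \<inter> fst d \<and> snd c (q t) = snd c p \<and> \<pi> (q t) = t" if tU: "(snd c p, t) \<in> U" for t
  proof -
    obtain x where "x \<in> fst c \<inter> fst d" "(snd c p, t) = snd (total_chart \<pi> c) x"
      using tU unfolding U_def by blast
    then have x: "x \<in> fst c \<inter> fst d" "snd c x = snd c p" "\<pi> x = t"
      by (simp_all add: total_chart_def)
    then have "q t = x" using chart_inv_apply[OF c, of x] by (simp add: q_def total_chart_def)
    with x show ?thesis by simp
  qed
  have ev: "eventually (\<lambda>t. (snd c p, t) \<in> U) (at t0)"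
    using \<open>open U\<close> z by (rule eventually_slice)
  show "eventually (\<lambda>t. q t \<in> fst c \<inter> fst d \<and> \<pi> (q t) = t) (at t0)"
    using ev by (rule eventually_mono) (use qU in blast)
  have q0: "q t0 = p" using chart_inv_apply[OF c, of p] p by (simp add: q_def total_chart_def)
  have "Ck_on 0 T U" and C1: "Ck_on (Suc 0) T U" using sm by (simp_all only: smooth_on_def T_def U_def)
  then have "continuous_on U T" by simp
  from tendsto_fst[OF tendsto_slice[OF this \<open>open U\<close> z]]
  have "((\<lambda>t. fst (T (snd c p, t))) \<longlongrightarrow> fst (T (snd c p, t0))) (at t0)" .
  moreover have "fst (T (snd c p, t)) = snd d (q t)" for t
    by (simp add: T_def transition_def q_def total_chart_def)
  ultimately show "((\<lambda>t. snd d (q t)) \<longlongrightarrow> snd d p) (at t0)"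
    by (simp add: q0)
  define X where "X t = (\<chi> i j. fst (frechet_derivative T (at (snd c p, t)) (axis j 1, 0)) $ i)" for t
  have "continuous_on U (\<lambda>x. frechet_derivative T (at x) v)" for v
    using C1 by (cases v) simp
  from tendsto_slice[OF this \<open>open U\<close> z]
  have lim: "(X \<longlongrightarrow> X t0) (at t0)"
    unfolding X_def by (intro tendsto_vec_lambda tendsto_vec_nth tendsto_fst)
  have ev_eq: "eventually (\<lambda>t. X t = tangent_change (fibre_chart \<pi> t c) (fibre_chart \<pi> t d) (q t)) (at t0)"
    using ev
  proof eventually_elim
    case (elim t)
    from qU[OF this] show ?case
      using tangent_change_fibre[OF c d sm, of "q t" t] by (simp add: X_def T_def)
  qed
  have "X t0 = tangent_change (fibre_chart \<pi> t0 c) (fibre_chart \<pi> t0 d) p"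
    using tangent_change_fibre[OF c d sm p] by (simp add: X_def T_def)
  with Lim_transform_eventually[OF lim ev_eq] show "((\<lambda>t. tangent_change (fibre_chart \<pi> t c) (fibre_chart \<pi> t d) (q t))
      \<longlongrightarrow> tangent_change (fibre_chart \<pi> t0 c) (fibre_chart \<pi> t0 d) p) (at t0)"
    by simp
qed

section \<open>The limiting coframe\<close>

locale orthonormal_family =
  fixes \<epsilon> :: real
    and M :: "'m::{t2_space,second_countable_topology} set"
    and \<pi> :: "'m \<Rightarrow> real"
    and F :: "('m, complex^'n) chart set"
    and g :: "real \<Rightarrow> ('m, 'n::finite) metric"
    and \<phi> :: "real \<Rightarrow> 'n \<Rightarrow> ('m, 'n) one_form"
  assumes eps: "\<epsilon> > 0"
    and family: "hermitian_family {-\<epsilon><..<1} M \<pi> F g"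
    and coframe: "\<And>t. t \<in> {0<..<1} \<Longrightarrow> holomorphic_coframe (fibre_atlas \<pi> F t) (\<phi> t)"
    and orthonormal: "\<And>t. t \<in> {0<..<1} \<Longrightarrow> orthonormal_coframe (fibre_atlas \<pi> F t) (g t) (\<phi> t)"
begin

section \<open>Coframes and metrics in the coordinates of the total space\<close>

abbreviation total_inv :: "('m, complex^'n) chart \<Rightarrow> complex^'n \<Rightarrow> real \<Rightarrow> 'm" where
  "total_inv c z t \<equiv> chart_inv (total_chart \<pi> c) (z, t)"

text \<open>Written as a function of the coordinate value, the i-th form becomes comparable across
  fibres: the varying point of the manifold is replaced by a fixed \<open>z\<close>.\<close>

definition coeff :: "('m, complex^'n) chart \<Rightarrow> 'n \<Rightarrow> real \<Rightarrow> complex^'n \<Rightarrow> complex^'n" where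
  "coeff c i t z = \<phi> t i (fibre_chart \<pi> t c) (total_inv c z t)"

definition metric_at :: "('m, complex^'n) chart \<Rightarrow> real \<Rightarrow> complex^'n \<Rightarrow> complex^'n^'n" where
  "metric_at c t z = g t (fibre_chart \<pi> t c) (total_inv c z t)"

lemma total_chart_on: "c \<in> F \<Longrightarrow> chart_on M (total_chart \<pi> c)"
  using family by (auto simp: hermitian_family_def differentiable_family_def smooth_manifold_def)

lemma open_total_image: "c \<in> F \<Longrightarrow> open (chart_image (total_chart \<pi> c))"
  using total_chart_on by (auto simp: chart_on_def)

lemma smooth_transition:
  "c \<in> F \<Longrightarrow> d \<in> F \<Longrightarrow> smooth_on (transition (total_chart \<pi> c) (total_chart \<pi> d))
      (snd (total_chart \<pi> c) ` (fst c \<inter> fst d))"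
  using family
  by (auto simp: hermitian_family_def differentiable_family_def smooth_manifold_def total_chart_def)

lemma total_inv_apply: "c \<in> F \<Longrightarrow> p \<in> fst c \<Longrightarrow> total_inv c (snd c p) (\<pi> p) = p"
  using chart_inv_apply[OF total_chart_on] by (simp add: total_chart_def)

lemma hermitian_metric_at:
  assumes "c \<in> F" "(z, t) \<in> chart_image (total_chart \<pi> c)" "t \<in> {-\<epsilon><..<1}"
  shows "hermitian_inner_product (metric_at c t z)"
proof -
  have "hermitian_metric (fibre_atlas \<pi> F t) (g t)"
    using family assms(3) by (simp add: hermitian_family_def)
  moreover have "fibre_chart \<pi> t c \<in> fibre_atlas \<pi> F t" using assms(1) by (simp add: fibre_atlas_def)
  moreover have "total_inv c z t \<in> fst (fibre_chart \<pi> t c)"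
    using total_chart_inv[OF assms(2)] by (simp add: fibre_chart_def fibre_def)
  ultimately show ?thesis by (simp add: hermitian_metric_def metric_at_def)
qed

lemma sesquilinear_metric_at:
  assumes "c \<in> F" "(z, t) \<in> chart_image (total_chart \<pi> c)" "t \<in> {0<..<1}"
  defines "P \<equiv> \<chi> i. coeff c i t z"
  shows "sesquilinear (metric_at c t z) u u = (\<Sum>i\<in>UNIV. (P *v u) $ i * cnj ((P *v u) $ i))"
proof (rule sesquilinear_orthonormal)
  show "hermitian_inner_product (metric_at c t z)"
    using assms eps by (intro hermitian_metric_at) auto
  have "fibre_chart \<pi> t c \<in> fibre_atlas \<pi> F t" using assms(1) by (simp add: fibre_atlas_def)
  moreover have "total_inv c z t \<in> fst (fibre_chart \<pi> t c)"
    using total_chart_inv[OF assms(2)] by (simp add: fibre_chart_def fibre_def)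
  ultimately show "dual_inner_product (metric_at c t z) (P $ i) (P $ j) = (if i = j then 1 else 0)" for i j
    using orthonormal[OF assms(3)] by (simp add: orthonormal_coframe_def metric_at_def P_def coeff_def)
qed

lemma continuous_metric_at:
  assumes "c \<in> F"
  shows "continuous_on (chart_image (total_chart \<pi> c)) (\<lambda>(z, t). metric_at c t z)"
proof -
  let ?g = "(\<lambda>p. g (\<pi> p) (fibre_chart \<pi> (\<pi> p) c) p) \<circ> chart_inv (total_chart \<pi> c)"
  have "smooth_on ?g (chart_image (total_chart \<pi> c))"
    using family assms by (simp add: hermitian_family_def)
  then have "Ck_on 0 ?g (chart_image (total_chart \<pi> c))" unfolding smooth_on_def by blast
  then have "continuous_on (chart_image (total_chart \<pi> c)) ?g" by simp
  then show ?thesis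
    by (rule continuous_on_eq) (auto simp: metric_at_def total_chart_inv)
qed

section \<open>Uniform bounds near the central fibre and a convergent subfilter\<close>

lemma eventually_unit_interval: "eventually (\<lambda>t::real. t \<in> {0<..<1}) (at_right 0)"
  using eventually_at_right_real[of 0 1] by simp

text \<open>The metric coefficients are continuous at \<open>(z0, 0)\<close>, hence bounded nearby,
  and by orthonormality they bound the rows of the coframe matrix. One ball in \<open>z\<close> must
  serve all small \<open>t\<close>, as the Cauchy estimates need a radius independent of
  \<open>t\<close>.\<close>

lemma coeff_locally_bounded:
  assumes "c \<in> F" "(z0, 0) \<in> chart_image (total_chart \<pi> c)"
  obtains r B where "r > 0" "ball z0 r \<subseteq> {z. (z, 0) \<in> chart_image (total_chart \<pi> c)}"
    "eventually (\<lambda>t. \<forall>z\<in>ball z0 r. (z, t) \<in> chart_image (total_chart \<pi> c) \<and>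
      (\<forall>i. norm (coeff c i t z) \<le> B)) (at_right 0)"
proof -
  define U where "U = chart_image (total_chart \<pi> c)"
  define B where "B = norm (metric_at c 0 z0) + 1"
  define V where "V = U \<inter> (\<lambda>(z, t). metric_at c t z) -` ball 0 B"
  have "open V"
    unfolding V_def U_def
    using continuous_metric_at open_total_image assms(1) by (intro continuous_open_preimage) auto
  moreover have "(z0, 0) \<in> V" using assms(2) by (simp add: V_def U_def B_def)
  ultimately obtain e where e: "e > 0" "ball (z0, 0) e \<subseteq> V" by (meson openE)
  \<comment> \<open>The product of a ball and an interval, both of radius \<open>e/2\<close>, fits
    into the ball of radius \<open>e\<close> because the product distance is at most the sum of the
    distances.\<close>
  have near: "(z, t) \<in> U \<and> norm (metric_at c t z) < B" if "z \<in> ball z0 (e/2)" "\<bar>t\<bar> < e/2" for z t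
  proof -
    have "dist (z0, 0) (z, t) \<le> dist z0 z + dist 0 t"
      unfolding dist_Pair_Pair by (intro sqrt_sum_squares_le_sum) auto
    also have "\<dots> < e" using that by (simp add: dist_norm)
    finally have "(z, t) \<in> ball (z0, 0) e" by simp
    with e(2) have "(z, t) \<in> V" by blast
    then show ?thesis by (simp add: V_def)
  qed
  have "eventually (\<lambda>t::real. t \<in> {0<..<e/2}) (at_right 0)"
    using eventually_at_right_real[of 0 "e/2"] e(1) by simp
  with eventually_unit_interval
  have "eventually (\<lambda>t. \<forall>z\<in>ball z0 (e/2). (z, t) \<in> chart_image (total_chart \<pi> c) \<and>
      (\<forall>i. norm (coeff c i t z) \<le> CARD('n) * (B + 1))) (at_right 0)"
  proof eventually_elim
    case (elim t)
    show ?case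
    proof (intro ballI conjI allI)
      fix z i assume "z \<in> ball z0 (e/2)"
      with near[of z t] elim have zt: "(z, t) \<in> U" "norm (metric_at c t z) < B" by auto
      then show "(z, t) \<in> chart_image (total_chart \<pi> c)" by (simp add: U_def)
      with sesquilinear_metric_at[OF assms(1) _ elim(1)]
      have "norm ((\<chi> i. coeff c i t z) $ i) \<le> CARD('n) * (norm (metric_at c t z) + 1)"
        by (intro norm_row_le) auto
      also have "\<dots> \<le> CARD('n) * (B + 1)" using zt by (intro mult_left_mono) auto
      finally show "norm (coeff c i t z) \<le> CARD('n) * (B + 1)" by simp
    qed
  qed
  moreover have "ball z0 (e/2) \<subseteq> {z. (z, 0) \<in> chart_image (total_chart \<pi> c)}"
    using near[of _ 0] e(1) by (auto simp: U_def)
  ultimately show thesis using e(1) by (intro that[of "e/2"]) auto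
qed

lemma coeff_holomorphic:
  assumes "c \<in> F" "t \<in> {0<..<1}" "\<forall>z\<in>ball z0 r. (z, t) \<in> chart_image (total_chart \<pi> c)"
  shows "holomorphic_map_on (coeff c i t) (ball z0 r)"
proof (rule holomorphic_map_on_cong_subset)
  show "holomorphic_map_on (\<phi> t i (fibre_chart \<pi> t c) \<circ> chart_inv (fibre_chart \<pi> t c))
      (chart_image (fibre_chart \<pi> t c))"
    using coframe[OF assms(2)] assms(1)
    by (simp add: holomorphic_coframe_def holomorphic_one_form_def fibre_atlas_def)
  show "ball z0 r \<subseteq> chart_image (fibre_chart \<pi> t c)"
    using assms(3) by (auto simp: chart_image_fibre)
  show "(\<phi> t i (fibre_chart \<pi> t c) \<circ> chart_inv (fibre_chart \<pi> t c)) z = coeff c i t z"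
    if "z \<in> ball z0 r" for z
    using fibre_chart_inv[OF total_chart_on[OF assms(1)], of z t] assms(3) that
    by (simp add: coeff_def)
qed simp

lemma coeff_change:
  assumes "c \<in> F" "d \<in> F" "t \<in> {0<..<1}" "p \<in> fst c \<inter> fst d" "\<pi> p = t"
  shows "coeff c i t (snd c p) = coeff d i t (snd d p) v* tangent_change (fibre_chart \<pi> t c) (fibre_chart \<pi> t d) p"
proof -
  have "total_inv c (snd c p) t = p" "total_inv d (snd d p) t = p"
    using total_inv_apply[OF assms(1), of p] total_inv_apply[OF assms(2), of p] assms(4,5) by simp_all
  moreover have "p \<in> fst (fibre_chart \<pi> t c) \<inter> fst (fibre_chart \<pi> t d)"
    using assms by (simp add: fibre_chart_def fibre_def)
  moreover have "fibre_chart \<pi> t c \<in> fibre_atlas \<pi> F t" "fibre_chart \<pi> t d \<in> fibre_atlas \<pi> F t"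
    using assms(1,2) by (simp_all add: fibre_atlas_def)
  moreover have "holomorphic_one_form (fibre_atlas \<pi> F t) (\<phi> t i)"
    using coframe[OF assms(3)] by (simp add: holomorphic_coframe_def)
  ultimately show ?thesis
    unfolding coeff_def holomorphic_one_form_def by metis
qed

lemma coeff_subfilter:
  obtains G L where "G \<noteq> bot" "G \<le> at_right 0"
    "\<And>c i z. c \<in> F \<Longrightarrow> (z, 0) \<in> chart_image (total_chart \<pi> c) \<Longrightarrow>
      ((\<lambda>t. coeff c i t z) \<longlongrightarrow> L c i z) G"
proof -
  \<comment> \<open>An index is a chart, a number of a form and a coordinate value. Treating all of
    them in one product yields a single filter, so that limits in different charts can be
    compared.\<close>
  define I where "I = {(c, i::'n, z). c \<in> F \<and> (z, 0) \<in> chart_image (total_chart \<pi> c)}"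
  have "\<exists>R. eventually (\<lambda>t. norm (case x of (c, i, z) \<Rightarrow> coeff c i t z) \<le> R) (at_right 0)" if "x \<in> I" for x
  proof -
    obtain c i z where x: "x = (c, i, z)" by (metis prod_cases3)
    with that have "c \<in> F" "(z, 0) \<in> chart_image (total_chart \<pi> c)" by (auto simp: I_def)
    then obtain r B where "r > 0" and
      ev: "eventually (\<lambda>t. \<forall>z\<in>ball z r. (z, t) \<in> chart_image (total_chart \<pi> c) \<and>
      (\<forall>i. norm (coeff c i t z) \<le> B)) (at_right 0)"
      by (rule coeff_locally_bounded)
    have "eventually (\<lambda>t. norm (coeff c i t z) \<le> B) (at_right 0)"
      using ev by (rule eventually_mono) (use \<open>r > 0\<close> in simp)
    with x show ?thesis by auto
  qed
  then obtain R where "\<And>x. x \<in> I \<Longrightarrow>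
      eventually (\<lambda>t. norm (case x of (c, i, z) \<Rightarrow> coeff c i t z) \<le> R x) (at_right 0)"
    by metis
  then obtain G L where "G \<noteq> bot" "G \<le> at_right 0"
    and L: "\<And>x. x \<in> I \<Longrightarrow> ((\<lambda>t. case x of (c, i, z) \<Rightarrow> coeff c i t z) \<longlongrightarrow> L x) G"
    using pointwise_convergent_subfilter[of "at_right (0::real)" I "\<lambda>t (c, i, z). coeff c i t z" R]
    by (metis trivial_limit_at_right_real)
  moreover have "((\<lambda>t. coeff c i t z) \<longlongrightarrow> L (c, i, z)) G"
    if "c \<in> F" "(z, 0) \<in> chart_image (total_chart \<pi> c)" for c i z
    using L[of "(c, i, z)"] that by (simp add: I_def)
  ultimately show thesis using that[of G "\<lambda>c i z. L (c, i, z)"] by blast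
qed

section \<open>Properties of the limit along a fixed subfilter\<close>

context
  fixes G :: "real filter" and L :: "('m, complex^'n) chart \<Rightarrow> 'n \<Rightarrow> complex^'n \<Rightarrow> complex^'n"
  assumes G: "G \<noteq> bot" "G \<le> at_right 0"
    and L: "\<And>c i z. c \<in> F \<Longrightarrow> (z, 0) \<in> chart_image (total_chart \<pi> c) \<Longrightarrow>
      ((\<lambda>t. coeff c i t z) \<longlongrightarrow> L c i z) G"
begin

lemma limit_holomorphic:
  assumes "c \<in> F"
  shows "holomorphic_map_on (L c i) {z. (z, 0) \<in> chart_image (total_chart \<pi> c)}"
  unfolding holomorphic_map_on_def
proof
  fix z assume "z \<in> {z. (z, 0) \<in> chart_image (total_chart \<pi> c)}"
  then have "(z, 0) \<in> chart_image (total_chart \<pi> c)" by simp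
  with assms obtain r B where r: "r > 0" "ball z r \<subseteq> {z. (z, 0) \<in> chart_image (total_chart \<pi> c)}"
    and ev: "eventually (\<lambda>t. \<forall>z\<in>ball z r. (z, t) \<in> chart_image (total_chart \<pi> c) \<and>
      (\<forall>i. norm (coeff c i t z) \<le> B)) (at_right 0)"
    by (rule coeff_locally_bounded)
  show "\<exists>D. (L c i has_derivative D) (at z) \<and> (\<forall>k v. D (k *s v) = k *s D v)"
  proof (rule holomorphic_map_on_limit[OF G(1) r(1)])
    show "eventually (\<lambda>t. holomorphic_map_on (coeff c i t) (ball z r)) G"
      using filter_leD[OF G(2) ev] filter_leD[OF G(2) eventually_unit_interval]
      by eventually_elim (use coeff_holomorphic[OF assms] in blast)
    show "eventually (\<lambda>t. \<forall>x\<in>ball z r. norm (coeff c i t x) \<le> B) G"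
      using filter_leD[OF G(2) ev] by (rule eventually_mono) blast
    show "((\<lambda>t. coeff c i t x) \<longlongrightarrow> L c i x) G" if "x \<in> ball z r" for x
      using L assms r(2) that by blast
  qed
qed

text \<open>The coordinates of a point in a second chart depend on \<open>t\<close>, so pointwise convergence is not
  enough: the Cauchy estimates make it locally uniform.\<close>

lemma limit_along:
  assumes "d \<in> F" "(w, 0) \<in> chart_image (total_chart \<pi> d)" and v: "(v \<longlongrightarrow> w) G"
  shows "((\<lambda>t. coeff d i t (v t)) \<longlongrightarrow> L d i w) G"
proof -
  from assms(1,2) obtain r B where r: "r > 0"
    and ev: "eventually (\<lambda>t. \<forall>z\<in>ball w r. (z, t) \<in> chart_image (total_chart \<pi> d) \<and>
      (\<forall>i. norm (coeff d i t z) \<le> B)) (at_right 0)"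
    by (rule coeff_locally_bounded)
  \<comment> \<open>The Cauchy estimate bounds the variation of the coefficients away from the
    centre \<open>w\<close> by this constant times the distance, on the half ball and uniformly in
    \<open>t\<close>. The moving argument \<open>v t\<close> may therefore be replaced by
    \<open>w\<close>.\<close>
  define C where "C = 4 * real CARD('n) * B / r"
  have "eventually (\<lambda>t. dist (v t) w < r/2) G"
    using v r by (intro tendstoD) auto
  then have "eventually (\<lambda>t. norm (coeff d i t (v t) - coeff d i t w) \<le> C * norm (v t - w)) G"
    using filter_leD[OF G(2) ev] filter_leD[OF G(2) eventually_unit_interval]
  proof eventually_elim
    case (elim t)
    have hol: "holomorphic_map_on (coeff d i t) (ball w r)"
      using coeff_holomorphic[OF assms(1)] elim by blast
    then obtain D where D: "(coeff d i t has_derivative D) (at w)"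
      using r unfolding holomorphic_map_on_def by (metis centre_in_ball)
    show ?case
      using holomorphic_map_bounds(1)[OF hol _ r _ D, of B "v t - w"] elim
      by (simp add: C_def dist_norm)
  qed
  moreover have "((\<lambda>t. C * norm (v t - w)) \<longlongrightarrow> C * norm (w - w)) G"
    using v by (intro tendsto_intros)
  then have "((\<lambda>t. C * norm (v t - w)) \<longlongrightarrow> 0) G" by simp
  ultimately have "((\<lambda>t. coeff d i t (v t) - coeff d i t w) \<longlongrightarrow> 0) G"
    by (rule Lim_null_comparison)
  from tendsto_add[OF this L[OF assms(1,2), of i]] show ?thesis by simp
qed

text \<open>The transformation law is applied at the point \<open>q t\<close> over \<open>t\<close>
  whose coordinates in \<open>c\<close> are those of \<open>p\<close>. One side is then a
  coefficient at a fixed coordinate value and converges by the choice of \<open>G\<close>; the other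
  side has moving coordinates in \<open>d\<close> and converges by \<open>limit_along\<close>
  together with the convergence of the Jacobians.\<close>

lemma limit_change:
  assumes "c \<in> F" "d \<in> F" "p \<in> fst c \<inter> fst d" "\<pi> p = 0"
  shows "L c i (snd c p) = L d i (snd d p) v* tangent_change (fibre_chart \<pi> 0 c) (fibre_chart \<pi> 0 d) p"
proof (rule tendsto_unique[OF G(1)])
  define q where "q t = total_inv c (snd c p) t" for t
  define X where "X t = tangent_change (fibre_chart \<pi> t c) (fibre_chart \<pi> t d) (q t)" for t
  have zc: "(snd c p, 0) \<in> chart_image (total_chart \<pi> c)"
    and zd: "(snd d p, 0) \<in> chart_image (total_chart \<pi> d)"
    using assms by (auto simp: chart_image_total)
  show "((\<lambda>t. coeff c i t (snd c p)) \<longlongrightarrow> L c i (snd c p)) G"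
    using L assms(1) zc by blast
  have "G \<le> at 0" using G(2) at_le[of "{0<..}" UNIV "0::real"] by simp
  note tc = tangent_change_tendsto[OF total_chart_on total_chart_on smooth_transition, OF assms(1,2,1,2,3,4), folded q_def]
  have "((\<lambda>t. coeff d i t (snd d (q t))) \<longlongrightarrow> L d i (snd d p)) G"
    using limit_along[OF assms(2) zd] tendsto_mono[OF \<open>G \<le> at 0\<close> tc(2)] by blast
  moreover have "(X \<longlongrightarrow> tangent_change (fibre_chart \<pi> 0 c) (fibre_chart \<pi> 0 d) p) G"
    using tendsto_mono[OF \<open>G \<le> at 0\<close> tc(3)] by (simp add: X_def[abs_def])
  ultimately have "((\<lambda>t. coeff d i t (snd d (q t)) v* X t) \<longlongrightarrow>
      L d i (snd d p) v* tangent_change (fibre_chart \<pi> 0 c) (fibre_chart \<pi> 0 d) p) G"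
    unfolding vector_matrix_mult_def by (intro tendsto_intros)
  moreover have "eventually (\<lambda>t. coeff d i t (snd d (q t)) v* X t = coeff c i t (snd c p)) G"
    using filter_leD[OF \<open>G \<le> at 0\<close> tc(1)] filter_leD[OF G(2) eventually_unit_interval]
      filter_leD[OF \<open>G \<le> at 0\<close> eventually_slice[OF open_total_image[OF assms(1)] zc]]
  proof eventually_elim
    case (elim t)
    have "snd c (q t) = snd c p" using total_chart_inv(2)[OF elim(3)] by (simp add: q_def)
    with coeff_change[OF assms(1,2) elim(2), of "q t" i] elim(1) show ?case by (simp add: X_def)
  qed
  ultimately show "((\<lambda>t. coeff c i t (snd c p)) \<longlongrightarrow>
      L d i (snd d p) v* tangent_change (fibre_chart \<pi> 0 c) (fibre_chart \<pi> 0 d) p) G"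
    by (rule Lim_transform_eventually)
qed

text \<open>As 0 is interior to the parameter interval, the limit of the metrics is itself a metric,
  hence positive definite. This keeps the limiting forms from degenerating.\<close>

lemma limit_invertible:
  assumes "c \<in> F" "(z, 0) \<in> chart_image (total_chart \<pi> c)"
  shows "invertible (\<chi> i. L c i z)"
proof (rule invertible_if_sesquilinear)
  show "hermitian_inner_product (metric_at c 0 z)"
    using assms eps by (intro hermitian_metric_at) auto
  fix u
  have "G \<le> at 0" using G(2) at_le[of "{0<..}" UNIV "0::real"] by simp
  have g: "((\<lambda>t. metric_at c t z) \<longlongrightarrow> metric_at c 0 z) G"
    using tendsto_mono[OF \<open>G \<le> at 0\<close> tendsto_slice[OF continuous_metric_at[OF assms(1)]
      open_total_image[OF assms(1)] assms(2)]] by simp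
  show "sesquilinear (metric_at c 0 z) u u =
      (\<Sum>i\<in>UNIV. ((\<chi> i. L c i z) *v u) $ i * cnj (((\<chi> i. L c i z) *v u) $ i))"
  proof (rule tendsto_unique[OF G(1)])
    show "((\<lambda>t. sesquilinear (metric_at c t z) u u) \<longlongrightarrow> sesquilinear (metric_at c 0 z) u u) G"
      unfolding sesquilinear_def by (intro tendsto_intros g)
    have "((\<lambda>t. \<Sum>i\<in>UNIV. ((\<chi> i. coeff c i t z) *v u) $ i * cnj (((\<chi> i. coeff c i t z) *v u) $ i)) \<longlongrightarrow>
        (\<Sum>i\<in>UNIV. ((\<chi> i. L c i z) *v u) $ i * cnj (((\<chi> i. L c i z) *v u) $ i))) G"
      unfolding matrix_vector_mult_def vec_lambda_beta by (intro tendsto_intros L assms)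
    moreover have "eventually (\<lambda>t. (\<Sum>i\<in>UNIV. ((\<chi> i. coeff c i t z) *v u) $ i * cnj (((\<chi> i. coeff c i t z) *v u) $ i))
        = sesquilinear (metric_at c t z) u u) G"
      using filter_leD[OF G(2) eventually_unit_interval]
        filter_leD[OF \<open>G \<le> at 0\<close> eventually_slice[OF open_total_image[OF assms(1)] assms(2)]]
      by eventually_elim (simp add: sesquilinear_metric_at[OF assms(1)])
    ultimately show "((\<lambda>t. sesquilinear (metric_at c t z) u u) \<longlongrightarrow>
        (\<Sum>i\<in>UNIV. ((\<chi> i. L c i z) *v u) $ i * cnj (((\<chi> i. L c i z) *v u) $ i))) G"
      by (rule Lim_transform_eventually)
  qed
qed

text \<open>Different charts in \<open>F\<close> may restrict to the same chart of the central fibre, hence the choice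
  of a representative \<open>rep\<close>.\<close>

lemma limit_coframe: "\<exists>\<psi>. holomorphic_coframe (fibre_atlas \<pi> F 0) \<psi>"
proof -
  define rep where "rep c' = (SOME c. c \<in> F \<and> fibre_chart \<pi> 0 c = c')" for c'
  have rep: "rep c' \<in> F" "fibre_chart \<pi> 0 (rep c') = c'" if "c' \<in> fibre_atlas \<pi> F 0" for c'
    using that someI_ex[of "\<lambda>c. c \<in> F \<and> fibre_chart \<pi> 0 c = c'"]
    by (auto simp: rep_def fibre_atlas_def)
  have snd_rep: "snd (rep c') = snd c'" if "c' \<in> fibre_atlas \<pi> F 0" for c'
    using arg_cong[OF rep(2)[OF that], of snd] by (simp add: fibre_chart_def)
  have fst_rep: "p \<in> fst (rep c') \<and> \<pi> p = 0" if "c' \<in> fibre_atlas \<pi> F 0" "p \<in> fst c'" for c' p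
    using that(2) arg_cong[OF rep(2)[OF that(1)], of fst] by (auto simp: fibre_chart_def fibre_def)
  \<comment> \<open>\<open>rep c'\<close> and \<open>c'\<close> share their coordinate map, so
    \<open>snd c' p\<close> is the coordinate value at which the limit in \<open>rep c'\<close> has
    to be read.\<close>
  define \<psi> where "\<psi> i c' p = L (rep c') i (snd c' p)" for i c' p
  have "holomorphic_one_form (fibre_atlas \<pi> F 0) (\<psi> i)" for i
    unfolding holomorphic_one_form_def
  proof (intro conjI ballI)
    fix c' d' p assume c': "c' \<in> fibre_atlas \<pi> F 0" and d': "d' \<in> fibre_atlas \<pi> F 0"
      and p: "p \<in> fst c' \<inter> fst d'"
    show "\<psi> i c' p = \<psi> i d' p v* tangent_change c' d' p"
      using limit_change[OF rep(1)[OF c'] rep(1)[OF d'], of p i] fst_rep[OF c'] fst_rep[OF d'] p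
        rep(2)[OF c'] rep(2)[OF d'] snd_rep[OF c'] snd_rep[OF d']
      by (simp add: \<psi>_def)
  next
    fix c' assume c': "c' \<in> fibre_atlas \<pi> F 0"
    have im: "chart_image c' = {z. (z, 0) \<in> chart_image (total_chart \<pi> (rep c'))}"
      using chart_image_fibre[of \<pi> 0 "rep c'"] rep(2)[OF c'] by simp
    show "holomorphic_map_on (\<psi> i c' \<circ> chart_inv c') (chart_image c')"
    proof (rule holomorphic_map_on_cong_subset)
      show "holomorphic_map_on (L (rep c') i) (chart_image c')"
        unfolding im by (rule limit_holomorphic[OF rep(1)[OF c']])
      show "open (chart_image c')"
        unfolding im by (rule open_slice[OF open_total_image[OF rep(1)[OF c']]])
      show "L (rep c') i z = (\<psi> i c' \<circ> chart_inv c') z" if "z \<in> chart_image c'" for z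
        using that by (simp add: \<psi>_def chart_inv_def chart_image_def f_inv_into_f)
    qed simp
  qed
  moreover have "invertible (\<chi> i. \<psi> i c' p)" if c': "c' \<in> fibre_atlas \<pi> F 0" and p: "p \<in> fst c'" for c' p
    unfolding \<psi>_def using fst_rep[OF c' p] snd_rep[OF c']
    by (intro limit_invertible rep(1)[OF c']) (auto simp: chart_image_total)
  ultimately show ?thesis unfolding holomorphic_coframe_def by blast
qed

end

lemma central_fibre_parallelizable: "holomorphically_parallelizable (fibre M \<pi> 0) (fibre_atlas \<pi> F 0)"
proof -
  have df: "differentiable_family {-\<epsilon><..<1} M \<pi> F" using family by (simp add: hermitian_family_def)
  have "complex_manifold (fibre M \<pi> 0) (fibre_atlas \<pi> F 0)"
    using df eps by (simp add: differentiable_family_def)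
  \<comment> \<open>Properness of the family, applied to the one-point set.\<close>
  moreover have "compact {p \<in> M. \<pi> p \<in> {0}}"
    using df eps unfolding differentiable_family_def by (elim conjE allE[of _ "{0}"]) simp
  then have "compact (fibre M \<pi> 0)" by (simp add: fibre_def)
  moreover have "\<exists>\<psi>. holomorphic_coframe (fibre_atlas \<pi> F 0) \<psi>"
    by (rule coeff_subfilter, rule limit_coframe)
  ultimately show ?thesis by (simp add: holomorphically_parallelizable_def)
qed

end

theorem theorem1p3:
  fixes \<epsilon> :: real
    and M :: "'m::{t2_space,second_countable_topology} set"
    and \<pi> :: "'m \<Rightarrow> real"
    and F :: "('m, complex^'n) chart set"
    and g :: "real \<Rightarrow> ('m, 'n::finite) metric"
    and \<phi> :: "real \<Rightarrow> 'n \<Rightarrow> ('m, 'n) one_form"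
  assumes "\<epsilon> > 0"
    and "hermitian_family {-\<epsilon><..<1} M \<pi> F g"
    and "\<And>t. t \<in> {0<..<1} \<Longrightarrow> holomorphically_parallelizable (fibre M \<pi> t) (fibre_atlas \<pi> F t)"
    and "\<And>t. t \<in> {0<..<1} \<Longrightarrow> holomorphic_coframe (fibre_atlas \<pi> F t) (\<phi> t)"
    and "\<And>t. t \<in> {0<..<1} \<Longrightarrow> orthonormal_coframe (fibre_atlas \<pi> F t) (g t) (\<phi> t)"
  shows "holomorphically_parallelizable (fibre M \<pi> 0) (fibre_atlas \<pi> F 0)"
proof -
  interpret orthonormal_family \<epsilon> M \<pi> F g \<phi>
    using assms by unfold_locales
  show ?thesis by (rule central_fibre_parallelizable)
qed

end
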